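(* Let $\mathcal{V}=\langle\Sigma_{rdz},S,R\rangle$ be a CVRS and $c,c'\in\mathbb{Q}_{\ge0}^S$ configurations. Then $c'$ is reachable from $c$ if and only if there are coefficients $\alpha_t\in\mathbb{Q}_{\ge0}$ for every $t\in R$ such that: (1) $c'=c+\sum_{t\in R}\alpha_t(\mathrm{in}(t)-\mathrm{out}(t))$; (2) for every $a\in\Sigma_{actn}$ and all $i,j\in[k]$, $\sum_{t\in R,\,\mathrm{rdz}(t)=a_i}\alpha_t=\sum_{t\in R,\,\mathrm{rdz}(t)=a_j}\alpha_t$; (3) for $R'=\{t\in R:\alpha_t>0\}$: $\mathrm{src}(R')\subseteq\mathrm{back}(c',R')$, $\mathrm{dst}(R')\subseteq\mathrm{forw}(c,R')$, and $\mathrm{forw}(c,R')=\mathrm{back}(c',R')$.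
   Context: Fix $k\ge1$, a finite set $\Sigma_{actn}$ of actions and $\Sigma_{rdz}=\{a_1,\dots,a_k:a\in\Sigma_{actn}\}$. A CVRS is $\mathcal{V}=\langle\Sigma_{rdz},S,R\rangle$ with finite state set $S$ and finite transition set $R\subseteq S\times\Sigma_{rdz}\times S$. Configurations are vectors in $\mathbb{Q}_{\ge0}^S$, compared pointwise. For $t=(p,\sigma,q)$: $\mathrm{rdz}(t)=\sigma$, $\mathrm{src}(t)=p$, $\mathrm{dst}(t)=q$, $\mathrm{out}(t)$ and $\mathrm{in}(t)$ the unit vectors at $p$ and $q$; $\mathrm{src},\mathrm{dst}$ lifted to sets elementwise. A step with multiplicity $\alpha\in\mathbb{Q}_{>0}$ from $c$ to $c'$ using $(t_1,\dots,t_k)\in R^k$ requires some $a\in\Sigma_{actn}$ with $\mathrm{rdz}(t_i)=a_i$, $c\ge\alpha\sum_i\mathrm{out}(t_i)$, and $c'=c+\alpha\sum_i(\mathrm{in}(t_i)-\mathrm{out}(t_i))$. A trace is a finite sequence of consecutive steps; $c'$ is reachable from $c$ if some trace leads from $c$ to $c'$. The support is $\mathrm{supp}(c)=\{s:c(s)>0\}$. For $R''\subseteq R$, a set $H\subseteq S$ is forward (resp. backward) $R''$-accessible from $c$ if there is a trace from $c$ to some $d$ (resp. from some $d$ to $c$) using only transitions from $R''$ with $\mathrm{supp}(d)=H$; $\mathrm{forw}(c,R'')$ (resp. $\mathrm{back}(c,R'')$) is the union of all sets forward (resp. backward) $R''$-accessible from $c$. *)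

theory Defs
  imports Complex_Main
begin

text \<open>
  The rendezvous letter $a_i$ is the pair \<open>(a, i)\<close>, with \<open>i\<close> ranging over \<open>{1..k}\<close>.
\<close>

type_synonym ('a, 's) transition = "'s \<times> ('a \<times> nat) \<times> 's"

definition src :: "('a, 's) transition \<Rightarrow> 's" where
  "src t = fst t"

definition rdz :: "('a, 's) transition \<Rightarrow> 'a \<times> nat" where
  "rdz t = fst (snd t)"

definition dst :: "('a, 's) transition \<Rightarrow> 's" where
  "dst t = snd (snd t)"

text \<open>
  The globally fixed arity $k$ and action set are carried along with the system; the rendezvous
  alphabet is determined by them.
\<close>

record ('a, 's) cvrs =
  arity :: nat
  actions :: "'a set"
  states :: "'s set"
  transitions :: "('a, 's) transition set"

definition rdz_alphabet :: "('a, 's) cvrs \<Rightarrow> ('a \<times> nat) set" where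
  "rdz_alphabet V = actions V \<times> {1..arity V}"

definition is_cvrs :: "('a, 's) cvrs \<Rightarrow> bool" where
  "is_cvrs V \<longleftrightarrow>
     1 \<le> arity V \<and> finite (actions V) \<and> finite (states V) \<and> finite (transitions V) \<and>
     transitions V \<subseteq> states V \<times> rdz_alphabet V \<times> states V"

text \<open>
  Vectors indexed by the state set \<open>S\<close> are functions on the whole type that vanish outside \<open>S\<close>,
  so that equality of functions is equality of vectors.
\<close>

definition configs :: "('a, 's) cvrs \<Rightarrow> ('s \<Rightarrow> rat) set" where
  "configs V = {c. (\<forall>s\<in>states V. 0 \<le> c s) \<and> (\<forall>s. s \<notin> states V \<longrightarrow> c s = 0)}"

definition unit_vec :: "'s \<Rightarrow> 's \<Rightarrow> rat" where
  "unit_vec p = (\<lambda>s. if s = p then 1 else 0)"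

definition out_vec :: "('a, 's) transition \<Rightarrow> 's \<Rightarrow> rat" where
  "out_vec t = unit_vec (src t)"

definition in_vec :: "('a, 's) transition \<Rightarrow> 's \<Rightarrow> rat" where
  "in_vec t = unit_vec (dst t)"

definition supp :: "('s \<Rightarrow> rat) \<Rightarrow> 's set" where
  "supp c = {s. 0 < c s}"

text \<open>
  The tuple $(t_1,\dots,t_k)$ is a list of length $k$; list positions start at \<open>0\<close>, whence the
  index shift in the rendezvous condition.
\<close>

definition step ::
  "('a, 's) cvrs \<Rightarrow> ('s \<Rightarrow> rat) \<Rightarrow> rat \<Rightarrow> ('a, 's) transition list \<Rightarrow> ('s \<Rightarrow> rat) \<Rightarrow> bool" where
  "step V c \<alpha> ts c' \<longleftrightarrow>
     c \<in> configs V \<and> c' \<in> configs V \<and> 0 < \<alpha> \<and>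
     length ts = arity V \<and> set ts \<subseteq> transitions V \<and>
     (\<exists>a\<in>actions V. \<forall>i<arity V. rdz (ts ! i) = (a, Suc i)) \<and>
     (\<forall>s\<in>states V. \<alpha> * (\<Sum>i<arity V. out_vec (ts ! i) s) \<le> c s) \<and>
     c' = (\<lambda>s. c s + \<alpha> * (\<Sum>i<arity V. in_vec (ts ! i) s - out_vec (ts ! i) s))"

inductive trace ::
  "('a, 's) cvrs \<Rightarrow> ('s \<Rightarrow> rat) \<Rightarrow> (rat \<times> ('a, 's) transition list) list \<Rightarrow> ('s \<Rightarrow> rat) \<Rightarrow> bool"
  for V where
  Nil: "c \<in> configs V \<Longrightarrow> trace V c [] c"
| Cons: "step V c \<alpha> ts d \<Longrightarrow> trace V d \<xi> c' \<Longrightarrow> trace V c ((\<alpha>, ts) # \<xi>) c'"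

definition used_transitions :: "(rat \<times> ('a, 's) transition list) list \<Rightarrow> ('a, 's) transition set"
  where
  "used_transitions \<xi> = (\<Union>(\<alpha>, ts)\<in>set \<xi>. set ts)"

definition reachable :: "('a, 's) cvrs \<Rightarrow> ('s \<Rightarrow> rat) \<Rightarrow> ('s \<Rightarrow> rat) \<Rightarrow> bool" where
  "reachable V c c' \<longleftrightarrow> (\<exists>\<xi>. trace V c \<xi> c')"

definition forward_accessible ::
  "('a, 's) cvrs \<Rightarrow> ('s \<Rightarrow> rat) \<Rightarrow> ('a, 's) transition set \<Rightarrow> 's set \<Rightarrow> bool" where
  "forward_accessible V c R'' H \<longleftrightarrow>
     (\<exists>\<xi> d. trace V c \<xi> d \<and> used_transitions \<xi> \<subseteq> R'' \<and> supp d = H)"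

definition backward_accessible ::
  "('a, 's) cvrs \<Rightarrow> ('s \<Rightarrow> rat) \<Rightarrow> ('a, 's) transition set \<Rightarrow> 's set \<Rightarrow> bool" where
  "backward_accessible V c R'' H \<longleftrightarrow>
     (\<exists>\<xi> d. trace V d \<xi> c \<and> used_transitions \<xi> \<subseteq> R'' \<and> supp d = H)"

definition forw :: "('a, 's) cvrs \<Rightarrow> ('s \<Rightarrow> rat) \<Rightarrow> ('a, 's) transition set \<Rightarrow> 's set" where
  "forw V c R'' = \<Union>{H. H \<subseteq> states V \<and> forward_accessible V c R'' H}"

definition backw :: "('a, 's) cvrs \<Rightarrow> ('s \<Rightarrow> rat) \<Rightarrow> ('a, 's) transition set \<Rightarrow> 's set" where
  "backw V c R'' = \<Union>{H. H \<subseteq> states V \<and> backward_accessible V c R'' H}"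

end

theory Submission
  imports Defs
begin

text \<open>
  Traces may be scaled and added, so the pairs \<open>(c, d)\<close> with \<open>d\<close> reachable from \<open>c\<close> form a convex
  cone; hence \<open>forw c R'\<close> and \<open>backw c' R'\<close> are themselves accessible sets. For the converse
  direction, mix \<open>c\<close> with a small portion \<open>\<epsilon>\<close> of a configuration whose support is \<open>forw c R'\<close>, and
  \<open>c'\<close> with the same portion of one whose support is \<open>backw c' R'\<close>. The two resulting points are
  positive on the same set of states, which contains \<open>src R'\<close>, and for small \<open>\<epsilon>\<close> they still differ
  by a nonnegative balanced flow supported in \<open>R'\<close>. Following the segment between them in
  sufficiently small increments never exhausts a state, and each increment splits greedily into
  rendezvous.
\<close>

section \<open>Flows on transitions and reachability through a fixed transition set\<close>

definition inflow :: "('a, 's) cvrs \<Rightarrow> (('a, 's) transition \<Rightarrow> rat) \<Rightarrow> 's \<Rightarrow> rat" where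
  "inflow V \<beta> s = (\<Sum>t\<in>transitions V. \<beta> t * in_vec t s)"

definition outflow :: "('a, 's) cvrs \<Rightarrow> (('a, 's) transition \<Rightarrow> rat) \<Rightarrow> 's \<Rightarrow> rat" where
  "outflow V \<beta> s = (\<Sum>t\<in>transitions V. \<beta> t * out_vec t s)"

definition balanced :: "('a, 's) cvrs \<Rightarrow> (('a, 's) transition \<Rightarrow> rat) \<Rightarrow> bool" where
  "balanced V \<beta> \<longleftrightarrow>
     (\<forall>a\<in>actions V. \<forall>i\<in>{1..arity V}. \<forall>j\<in>{1..arity V}.
        (\<Sum>t\<in>{t \<in> transitions V. rdz t = (a, i)}. \<beta> t) =
        (\<Sum>t\<in>{t \<in> transitions V. rdz t = (a, j)}. \<beta> t))"

definition rendezvous :: "('a, 's) cvrs \<Rightarrow> ('a, 's) transition list \<Rightarrow> bool" where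
  "rendezvous V ts \<longleftrightarrow> length ts = arity V \<and> set ts \<subseteq> transitions V \<and>
     (\<exists>a\<in>actions V. \<forall>i<arity V. rdz (ts ! i) = (a, Suc i))"

text \<open>For a rendezvous the indicator equals the multiplicity: its entries carry pairwise
  different letters, so no transition occurs twice (\<open>rendezvous_distinct\<close>).\<close>

definition ind :: "('a, 's) transition list \<Rightarrow> ('a, 's) transition \<Rightarrow> rat" where
  "ind ts t = of_bool (t \<in> set ts)"

text \<open>Hiding the trace turns reachability into a relation that composes and is closed under
  positive combinations; \<open>forw\<close> and \<open>backw\<close> are unions of supports along
  this relation.\<close>

definition reach_via ::
  "('a, 's) cvrs \<Rightarrow> ('a, 's) transition set \<Rightarrow> ('s \<Rightarrow> rat) \<Rightarrow> ('s \<Rightarrow> rat) \<Rightarrow> bool" where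
  "reach_via V T c d \<longleftrightarrow> (\<exists>\<xi>. trace V c \<xi> d \<and> used_transitions \<xi> \<subseteq> T)"

section \<open>Linearity and positivity of flows, configurations and supports\<close>

lemma sum_displacement:
  "(\<Sum>t\<in>transitions V. \<beta> t * (in_vec t s - out_vec t s)) = inflow V \<beta> s - outflow V \<beta> s"
  by (simp add: inflow_def outflow_def right_diff_distrib sum_subtractf)

lemma inflow_lincomb:
  "inflow V (\<lambda>t. p * \<beta> t + q * \<gamma> t) s = p * inflow V \<beta> s + q * inflow V \<gamma> s"
  by (simp add: inflow_def distrib_right sum.distrib sum_distrib_left mult.assoc)

lemma outflow_lincomb:
  "outflow V (\<lambda>t. p * \<beta> t + q * \<gamma> t) s = p * outflow V \<beta> s + q * outflow V \<gamma> s"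
  by (simp add: outflow_def distrib_right sum.distrib sum_distrib_left mult.assoc)

lemma balanced_lincomb:
  assumes "balanced V \<beta>" "balanced V \<gamma>"
  shows "balanced V (\<lambda>t. p * \<beta> t + q * \<gamma> t)"
  unfolding balanced_def
proof (intro ballI)
  fix a i j
  assume "a \<in> actions V" "i \<in> {1..arity V}" "j \<in> {1..arity V}"
  then have "(\<Sum>t\<in>{t \<in> transitions V. rdz t = (a, i)}. \<beta> t) =
        (\<Sum>t\<in>{t \<in> transitions V. rdz t = (a, j)}. \<beta> t)"
    "(\<Sum>t\<in>{t \<in> transitions V. rdz t = (a, i)}. \<gamma> t) =
        (\<Sum>t\<in>{t \<in> transitions V. rdz t = (a, j)}. \<gamma> t)"
    using assms unfolding balanced_def by blast+
  then show "(\<Sum>t\<in>{t \<in> transitions V. rdz t = (a, i)}. p * \<beta> t + q * \<gamma> t) =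
        (\<Sum>t\<in>{t \<in> transitions V. rdz t = (a, j)}. p * \<beta> t + q * \<gamma> t)"
    by (simp add: sum.distrib flip: sum_distrib_left)
qed

lemma in_vec_nonneg: "0 \<le> in_vec t s" and out_vec_nonneg: "0 \<le> out_vec t s"
  by (simp_all add: in_vec_def out_vec_def unit_vec_def)

lemma inflow_nonneg: "(\<And>t. t \<in> transitions V \<Longrightarrow> 0 \<le> \<beta> t) \<Longrightarrow> 0 \<le> inflow V \<beta> s"
  unfolding inflow_def by (intro sum_nonneg mult_nonneg_nonneg in_vec_nonneg)

lemma outflow_nonneg: "(\<And>t. t \<in> transitions V \<Longrightarrow> 0 \<le> \<beta> t) \<Longrightarrow> 0 \<le> outflow V \<beta> s"
  unfolding outflow_def by (intro sum_nonneg mult_nonneg_nonneg out_vec_nonneg)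

lemma outflow_posD:
  assumes "0 < outflow V \<beta> s"
  shows "\<exists>t\<in>transitions V. 0 < \<beta> t \<and> src t = s"
proof (rule ccontr)
  assume no: "\<not> ?thesis"
  have "outflow V \<beta> s \<le> 0"
    unfolding outflow_def
  proof (rule sum_nonpos)
    fix t assume "t \<in> transitions V"
    with no have "0 < \<beta> t \<Longrightarrow> src t \<noteq> s" by blast
    then show "\<beta> t * out_vec t s \<le> 0"
      by (cases "0 < \<beta> t") (auto simp: out_vec_def unit_vec_def)
  qed
  with assms show False by simp
qed

lemma configs_nonneg: "c \<in> configs V \<Longrightarrow> 0 \<le> c s"
  by (cases "s \<in> states V") (auto simp: configs_def)

lemma configs_lincomb:
  "c \<in> configs V \<Longrightarrow> d \<in> configs V \<Longrightarrow> 0 \<le> p \<Longrightarrow> 0 \<le> q \<Longrightarrow>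
    (\<lambda>s. p * c s + q * d s) \<in> configs V"
  by (auto simp: configs_def)

lemma supp_lincomb:
  assumes "c \<in> configs V" "d \<in> configs V" "0 < p" "0 < q"
  shows "supp (\<lambda>s. p * c s + q * d s) = supp c \<union> supp d"
proof -
  have "0 < p * c s + q * d s \<longleftrightarrow> 0 < c s \<or> 0 < d s" for s
  proof -
    have "0 \<le> c s" "0 \<le> d s" using assms by (auto intro: configs_nonneg)
    then have "0 \<le> p * c s" "0 \<le> q * d s" "0 < c s \<longleftrightarrow> 0 < p * c s" "0 < d s \<longleftrightarrow> 0 < q * d s"
      using assms by (auto simp: zero_less_mult_iff)
    then show ?thesis by linarith
  qed
  then show ?thesis by (auto simp: supp_def)
qed

lemma used_transitions_Nil [simp]: "used_transitions [] = {}"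
  and used_transitions_Cons [simp]:
    "used_transitions ((\<alpha>, ts) # \<xi>) = set ts \<union> used_transitions \<xi>"
  and used_transitions_append [simp]:
    "used_transitions (\<xi> @ \<zeta>) = used_transitions \<xi> \<union> used_transitions \<zeta>"
  by (auto simp: used_transitions_def)

text \<open>The Archimedean property, made uniform over a finite set: where \<open>f\<close>
  vanishes, \<open>g\<close> is nonpositive, so any factor works there. This yields the small
  portions 1/N used later; the bound N \<ge> 2 makes both 1/N and 1 - 1/N positive.\<close>

lemma finite_dominated:
  fixes f g :: "'b \<Rightarrow> rat"
  assumes "finite A" and "\<And>a. a \<in> A \<Longrightarrow> 0 \<le> f a" and "\<And>a. a \<in> A \<Longrightarrow> 0 < g a \<Longrightarrow> 0 < f a"
  shows "\<exists>N\<ge>2::nat. \<forall>a\<in>A. g a \<le> of_nat N * f a"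
  using assms
proof (induction A rule: finite_induct)
  case empty
  then show ?case by auto
next
  case (insert x A)
  then obtain N :: nat where N: "N \<ge> 2" "\<forall>a\<in>A. g a \<le> of_nat N * f a" by auto
  obtain M :: nat where M: "g x \<le> of_nat M * f x"
  proof (cases "0 < f x")
    case True
    then obtain M :: nat where "g x < of_nat M * f x" using ex_less_of_nat_mult by blast
    then show ?thesis using that less_imp_le by blast
  next
    case False
    then have "g x \<le> of_nat 0 * f x" using insert.prems by force
    then show ?thesis using that by blast
  qed
  \<comment> \<open>Since \<open>f\<close> is nonnegative, enlarging the factor preserves each
    bound.\<close>
  have "\<forall>a\<in>insert x A. g a \<le> of_nat (max M N) * f a"
  proof
    fix a assume a: "a \<in> insert x A"
    then have "0 \<le> f a" using insert.prems by blast
    then have "of_nat N * f a \<le> of_nat (max M N) * f a" "of_nat M * f a \<le> of_nat (max M N) * f a"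
      by (auto intro!: mult_right_mono)
    with a M N show "g a \<le> of_nat (max M N) * f a" by force
  qed
  then show ?case using N(1) by (intro exI[of _ "max M N"]) auto
qed

context
  fixes V :: "('a, 's) cvrs"
  assumes cvrs: "is_cvrs V"
begin

lemma finite_transitions: "finite (transitions V)" and finite_states: "finite (states V)"
  using cvrs by (auto simp: is_cvrs_def)

lemma src_in_states: "t \<in> transitions V \<Longrightarrow> src t \<in> states V"
  and dst_in_states: "t \<in> transitions V \<Longrightarrow> dst t \<in> states V"
  using cvrs by (auto simp: is_cvrs_def src_def dst_def)

lemma rdz_in_alphabet:
  assumes "t \<in> transitions V"
  obtains a i where "rdz t = (a, i)" "a \<in> actions V" "i \<in> {1..arity V}"
  using assms cvrs by (auto simp: is_cvrs_def rdz_def rdz_alphabet_def)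

lemma inflow_outside: "s \<notin> states V \<Longrightarrow> inflow V \<beta> s = 0"
  unfolding inflow_def
  by (rule sum.neutral) (auto simp: in_vec_def unit_vec_def dest: dst_in_states)

lemma outflow_outside: "s \<notin> states V \<Longrightarrow> outflow V \<beta> s = 0"
  unfolding outflow_def
  by (rule sum.neutral) (auto simp: out_vec_def unit_vec_def dest: src_in_states)

lemma supp_subset_states: "c \<in> configs V \<Longrightarrow> supp c \<subseteq> states V"
  by (force simp: configs_def supp_def)

section \<open>A step as the flow of a single rendezvous\<close>

text \<open>Position i carries the letter a_i, so equal entries force equal positions.\<close>

lemma rendezvous_distinct:
  assumes "rendezvous V ts"
  shows "distinct ts"
proof -
  obtain a where "\<And>i. i < arity V \<Longrightarrow> rdz (ts ! i) = (a, Suc i)" "length ts = arity V"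
    using assms unfolding rendezvous_def by blast
  then have "i = j" if "ts ! i = ts ! j" "i < length ts" "j < length ts" for i j
    using that by (metis nat.inject prod.inject)
  then show ?thesis unfolding distinct_conv_nth by blast
qed

text \<open>Passes from sums over tuple positions to sums over transitions, which is what makes the
  effect of a step a special case of \<open>inflow\<close> and \<open>outflow\<close>.\<close>

lemma rendezvous_sum:
  fixes f :: "('a, 's) transition \<Rightarrow> rat"
  assumes "rendezvous V ts"
  shows "(\<Sum>i<arity V. f (ts ! i)) = (\<Sum>t\<in>transitions V. ind ts t * f t)"
proof -
  have ts: "length ts = arity V" "set ts \<subseteq> transitions V"
    using assms by (auto simp: rendezvous_def)
  have "(\<Sum>i<arity V. f (ts ! i)) = sum_list (map f ts)"
    using ts by (simp add: sum_list_sum_nth atLeast0LessThan)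
  also have "\<dots> = sum f (set ts)"
    using rendezvous_distinct[OF assms] by (simp add: sum_list_distinct_conv_sum_set)
  also have "\<dots> = (\<Sum>t\<in>transitions V. ind ts t * f t)"
    using ts finite_transitions by (intro sum.mono_neutral_cong_left) (auto simp: ind_def)
  finally show ?thesis .
qed

text \<open>The working form of a step: its effect is the flow \<alpha> times \<open>ind ts\<close>.
  The guard may range over all of the type because outflow vanishes outside the state set and
  configurations are nonnegative.\<close>

lemma step_iff:
  "step V c \<alpha> ts d \<longleftrightarrow>
     c \<in> configs V \<and> d \<in> configs V \<and> 0 < \<alpha> \<and> rendezvous V ts \<and>
     (\<forall>s. \<alpha> * outflow V (ind ts) s \<le> c s) \<and>
     d = (\<lambda>s. c s + \<alpha> * (inflow V (ind ts) s - outflow V (ind ts) s))"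
proof (cases "rendezvous V ts")
  case True
  have "(\<Sum>i<arity V. out_vec (ts ! i) s) = outflow V (ind ts) s" for s
    using rendezvous_sum[OF True, of "\<lambda>t. out_vec t s"] by (simp add: outflow_def)
  moreover have "(\<Sum>i<arity V. in_vec (ts ! i) s - out_vec (ts ! i) s) =
      inflow V (ind ts) s - outflow V (ind ts) s" for s
    using rendezvous_sum[OF True, of "\<lambda>t. in_vec t s - out_vec t s"] by (simp add: sum_displacement)
  moreover have "(\<forall>s\<in>states V. \<alpha> * outflow V (ind ts) s \<le> c s) \<longleftrightarrow>
      (\<forall>s. \<alpha> * outflow V (ind ts) s \<le> c s)" if "c \<in> configs V"
    using that outflow_outside configs_nonneg by (metis mult_zero_right)
  ultimately show ?thesis
    using True unfolding step_def rendezvous_def by auto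
next
  case False
  then show ?thesis unfolding step_def rendezvous_def by blast
qed

text \<open>A rendezvous on a uses each letter a_i exactly once and no letter of another action, so
  every sum in question is 1 or 0, independently of the index.\<close>

lemma balanced_ind:
  assumes "rendezvous V ts"
  shows "balanced V (ind ts)"
proof -
  obtain a where a: "\<And>i. i < arity V \<Longrightarrow> rdz (ts ! i) = (a, Suc i)"
    and ts: "length ts = arity V" "set ts \<subseteq> transitions V"
    using assms unfolding rendezvous_def by blast
  have "(\<Sum>t\<in>{t \<in> transitions V. rdz t = (b, i)}. ind ts t) = of_bool (b = a)"
    if i: "i \<in> {1..arity V}" for b i
  proof -
    \<comment> \<open>Letters are numbered from 1 and list positions from 0, so a_i sits at position
      i - 1.\<close>
    have "{t \<in> transitions V. rdz t = (b, i)} \<inter> set ts = (if b = a then {ts ! (i - 1)} else {})"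
    proof -
      have 1: "b = a \<and> t = ts ! (i - 1)" if t: "t \<in> set ts" "rdz t = (b, i)" for t
      proof -
        obtain n where "n < arity V" "t = ts ! n" using t ts by (metis in_set_conv_nth)
        then show ?thesis using a t by auto
      qed
      have 2: "ts ! (i - 1) \<in> set ts" "rdz (ts ! (i - 1)) = (a, i)"
        using i ts a[of "i - 1"] by auto
      show ?thesis
      proof (cases "b = a")
        case True
        have "{t \<in> transitions V. rdz t = (b, i)} \<inter> set ts \<subseteq> {ts ! (i - 1)}" using 1 by blast
        moreover have "ts ! (i - 1) \<in> {t \<in> transitions V. rdz t = (b, i)} \<inter> set ts"
          using 2 ts(2) True by blast
        ultimately have "{t \<in> transitions V. rdz t = (b, i)} \<inter> set ts = {ts ! (i - 1)}"
          by (intro subset_antisym) simp_all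
        then show ?thesis using True by (simp only: if_True simp_thms)
      next
        case False
        then have "{t \<in> transitions V. rdz t = (b, i)} \<inter> set ts = {}" using 1 by blast
        then show ?thesis using False by (simp only: if_False simp_thms)
      qed
    qed
    moreover have "(\<Sum>t\<in>{t \<in> transitions V. rdz t = (b, i)}. ind ts t) =
        of_nat (card ({t \<in> transitions V. rdz t = (b, i)} \<inter> set ts))"
      using finite_transitions by (simp add: ind_def sum_of_bool_eq Collect_mem_eq)
    ultimately show ?thesis by auto
  qed
  then show ?thesis unfolding balanced_def by simp
qed

lemma inflow_ind_pos_iff:
  assumes "rendezvous V ts"
  shows "0 < inflow V (ind ts) s \<longleftrightarrow> s \<in> dst ` set ts"
proof -
  have sub: "set ts \<subseteq> transitions V" using assms by (simp add: rendezvous_def)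
  have "0 < inflow V (ind ts) s \<longleftrightarrow> inflow V (ind ts) s \<noteq> 0"
    using inflow_nonneg[of V "ind ts" s] by (auto simp: ind_def)
  also have "\<dots> \<longleftrightarrow> (\<exists>t\<in>transitions V. ind ts t * in_vec t s \<noteq> 0)"
    unfolding inflow_def using finite_transitions
    by (subst sum_nonneg_eq_0_iff) (auto simp: ind_def in_vec_nonneg)
  also have "\<dots> \<longleftrightarrow> s \<in> dst ` set ts"
    using sub by (auto simp: ind_def in_vec_def unit_vec_def)
  finally show ?thesis .
qed

lemma outflow_ind_pos_iff:
  assumes "rendezvous V ts"
  shows "0 < outflow V (ind ts) s \<longleftrightarrow> s \<in> src ` set ts"
proof -
  have sub: "set ts \<subseteq> transitions V" using assms by (simp add: rendezvous_def)
  have "0 < outflow V (ind ts) s \<longleftrightarrow> outflow V (ind ts) s \<noteq> 0"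
    using outflow_nonneg[of V "ind ts" s] by (auto simp: ind_def)
  also have "\<dots> \<longleftrightarrow> (\<exists>t\<in>transitions V. ind ts t * out_vec t s \<noteq> 0)"
    unfolding outflow_def using finite_transitions
    by (subst sum_nonneg_eq_0_iff) (auto simp: ind_def out_vec_nonneg)
  also have "\<dots> \<longleftrightarrow> s \<in> src ` set ts"
    using sub by (auto simp: ind_def out_vec_def unit_vec_def)
  finally show ?thesis .
qed

section \<open>Supports before and after steps and traces\<close>

text \<open>Both sides are the support of one vector: c + \<alpha> in = d + \<alpha> out pointwise,
  and all four summands are nonnegative.\<close>

lemma step_supp:
  assumes "step V c \<alpha> ts d"
  shows "supp c \<union> dst ` set ts = supp d \<union> src ` set ts"
proof -
  have st: "c \<in> configs V" "0 < \<alpha>" "rendezvous V ts"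
    "\<And>s. \<alpha> * outflow V (ind ts) s \<le> c s"
    "\<And>s. d s = c s + (\<alpha> * inflow V (ind ts) s - \<alpha> * outflow V (ind ts) s)"
    using assms by (auto simp: step_iff right_diff_distrib)
  have "0 < c s \<or> s \<in> dst ` set ts \<longleftrightarrow> 0 < d s \<or> s \<in> src ` set ts" for s
  proof -
    have "0 < \<alpha> * inflow V (ind ts) s \<longleftrightarrow> s \<in> dst ` set ts"
      "0 < \<alpha> * outflow V (ind ts) s \<longleftrightarrow> s \<in> src ` set ts"
      using st by (simp_all add: zero_less_mult_iff inflow_ind_pos_iff outflow_ind_pos_iff)
    moreover have "0 \<le> \<alpha> * inflow V (ind ts) s" "0 \<le> \<alpha> * outflow V (ind ts) s"
      using st by (auto intro!: mult_nonneg_nonneg inflow_nonneg outflow_nonneg simp: ind_def)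
    ultimately show ?thesis
      using st(4)[of s] st(5)[of s] configs_nonneg[OF st(1), of s] by linarith
  qed
  then show ?thesis by (auto simp: supp_def)
qed

lemma step_src_supp:
  assumes "step V c \<alpha> ts d" "s \<in> src ` set ts"
  shows "s \<in> supp c"
proof -
  have st: "0 < \<alpha>" "rendezvous V ts" "\<alpha> * outflow V (ind ts) s \<le> c s"
    using assms by (auto simp: step_iff)
  then have "0 < \<alpha> * outflow V (ind ts) s"
    using assms(2) outflow_ind_pos_iff by (intro mult_pos_pos) auto
  with st show ?thesis by (simp add: supp_def)
qed

text \<open>The guard c \<ge> \<alpha> out leaves d \<ge> \<alpha> in, which is positive at every
  destination.\<close>

lemma step_dst_supp:
  assumes "step V c \<alpha> ts d" "s \<in> dst ` set ts"
  shows "s \<in> supp d"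
proof -
  have st: "0 < \<alpha>" "rendezvous V ts" "\<alpha> * outflow V (ind ts) s \<le> c s"
    "d s = c s + (\<alpha> * inflow V (ind ts) s - \<alpha> * outflow V (ind ts) s)"
    using assms by (auto simp: step_iff right_diff_distrib)
  then have "0 < \<alpha> * inflow V (ind ts) s"
    using assms(2) inflow_ind_pos_iff by (intro mult_pos_pos) auto
  with st show ?thesis by (simp add: supp_def)
qed

text \<open>Accumulates \<open>step_supp\<close> along the trace. The two sides will turn out to be
  \<open>forw\<close> and \<open>backw\<close> for the used transitions, so this is the equality
  demanded in condition (3).\<close>

lemma trace_supp:
  "trace V c \<xi> d \<Longrightarrow>
    supp c \<union> dst ` used_transitions \<xi> = supp d \<union> src ` used_transitions \<xi>"
proof (induction rule: trace.induct)
  case (Cons c \<alpha> ts d \<xi> c')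
  then show ?case using step_supp[OF Cons.hyps(1)] by (simp add: image_Un) blast
qed simp

lemma trace_configs: "trace V c \<xi> d \<Longrightarrow> c \<in> configs V \<and> d \<in> configs V"
  by (induction rule: trace.induct) (auto simp: step_def)

section \<open>Composing, scaling and adding traces\<close>

lemma trace_append: "trace V c \<xi> d \<Longrightarrow> trace V d \<zeta> e \<Longrightarrow> trace V c (\<xi> @ \<zeta>) e"
  by (induction rule: trace.induct) (auto intro: trace.Cons)

text \<open>Multiplicities are rational, so a step scales freely, and an idle extra amount
  \<open>e\<close> only makes the guard easier to satisfy.\<close>

lemma step_scale_add:
  assumes "step V c \<alpha> ts d" "0 < r" "e \<in> configs V"
  shows "step V (\<lambda>s. r * c s + e s) (r * \<alpha>) ts (\<lambda>s. r * d s + e s)"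
proof -
  have "(r * \<alpha>) * outflow V (ind ts) s \<le> r * c s + e s" for s
  proof -
    have "r * (\<alpha> * outflow V (ind ts) s) \<le> r * c s"
      using assms by (intro mult_left_mono) (auto simp: step_iff)
    then show ?thesis using configs_nonneg[OF assms(3), of s] by (simp add: mult.assoc)
  qed
  then show ?thesis
    using assms configs_lincomb[of c V e r 1] configs_lincomb[of d V e r 1]
    by (auto simp: step_iff algebra_simps)
qed

lemma trace_scale_add:
  assumes "trace V c \<xi> d" "0 < r" "e \<in> configs V"
  shows "trace V (\<lambda>s. r * c s + e s) (map (map_prod ((*) r) id) \<xi>) (\<lambda>s. r * d s + e s)"
  using assms
proof (induction rule: trace.induct)
  case (Nil c)
  then show ?case using configs_lincomb[of c V e r 1] by (auto intro: trace.Nil)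
next
  case (Cons c \<alpha> ts d \<xi> c')
  then show ?case by (auto intro: trace.Cons step_scale_add)
qed

lemma used_transitions_scale:
  "used_transitions (map (map_prod f id) \<xi>) = used_transitions \<xi>"
  by (force simp: used_transitions_def)

lemma reach_via_refl: "c \<in> configs V \<Longrightarrow> reach_via V T c c"
  unfolding reach_via_def by (intro exI[of _ "[]"]) (auto intro: trace.Nil)

lemma reach_via_trans: "reach_via V T c d \<Longrightarrow> reach_via V T d e \<Longrightarrow> reach_via V T c e"
  unfolding reach_via_def by (metis trace_append used_transitions_append Un_least)

lemma reach_via_mono: "reach_via V T c d \<Longrightarrow> T \<subseteq> T' \<Longrightarrow> reach_via V T' c d"
  unfolding reach_via_def by blast

lemma reach_via_configs: "reach_via V T c d \<Longrightarrow> c \<in> configs V \<and> d \<in> configs V"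
  unfolding reach_via_def using trace_configs by blast

lemma reach_via_step: "step V c \<alpha> ts d \<Longrightarrow> set ts \<subseteq> T \<Longrightarrow> reach_via V T c d"
  unfolding reach_via_def
  by (intro exI[of _ "[(\<alpha>, ts)]"]) (auto intro!: trace.intros simp: step_def)

lemma reach_via_scale_add:
  assumes "reach_via V T c d" "0 < r" "e \<in> configs V"
  shows "reach_via V T (\<lambda>s. r * c s + e s) (\<lambda>s. r * d s + e s)"
proof -
  obtain \<xi> where "trace V c \<xi> d" "used_transitions \<xi> \<subseteq> T"
    using assms(1) unfolding reach_via_def by blast
  then show ?thesis
    unfolding reach_via_def using trace_scale_add[OF _ assms(2,3)] used_transitions_scale[of "(*) r" \<xi>]
    by (intro exI[of _ "map (map_prod ((*) r) id) \<xi>"]) simp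
qed

text \<open>The two traces run one after the other: first p c moves to p d while q c' is idle, then
  q c' moves to q d' while p d is idle.\<close>

lemma reach_via_lincomb:
  assumes "reach_via V T c d" "reach_via V T c' d'" "0 < p" "0 < q"
  shows "reach_via V T (\<lambda>s. p * c s + q * c' s) (\<lambda>s. p * d s + q * d' s)"
proof (rule reach_via_trans)
  have conf: "c' \<in> configs V" "d \<in> configs V" using assms reach_via_configs by blast+
  show "reach_via V T (\<lambda>s. p * c s + q * c' s) (\<lambda>s. p * d s + q * c' s)"
    using assms configs_lincomb[OF conf(1) conf(1), of q 0] by (intro reach_via_scale_add) auto
  show "reach_via V T (\<lambda>s. p * d s + q * c' s) (\<lambda>s. p * d s + q * d' s)"
    using reach_via_scale_add[OF assms(2,4), of "\<lambda>s. p * d s"] assms(3)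
      configs_lincomb[OF conf(2) conf(2), of p 0] by (simp add: add.commute)
qed

lemma reach_via_supp:
  assumes "reach_via V T c d"
  shows "supp d \<subseteq> supp c \<union> dst ` T" "supp c \<subseteq> supp d \<union> src ` T"
  using assms trace_supp unfolding reach_via_def by blast+

section \<open>Forward and backward accessible sets have a largest element\<close>

text \<open>The restriction to subsets of the state set is automatic, as configurations have their
  support there.\<close>

lemma forw_eq: "forw V c T = \<Union> {supp d |d. reach_via V T c d}"
  using supp_subset_states trace_configs
  unfolding forw_def forward_accessible_def reach_via_def by (intro arg_cong[of _ _ Union]) blast

lemma backw_eq: "backw V c T = \<Union> {supp d |d. reach_via V T d c}"
  using supp_subset_states trace_configs
  unfolding backw_def backward_accessible_def reach_via_def by (intro arg_cong[of _ _ Union]) blast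

text \<open>The midpoint of two configurations reachable from c is again reachable from c, and its
  support is the union of theirs. Since the state set is finite, finitely many midpoints collect all
  of \<open>forw\<close>.\<close>

lemma forw_attained:
  assumes "c \<in> configs V"
  shows "\<exists>d. reach_via V T c d \<and> supp d = forw V c T"
proof -
  have "\<exists>d. reach_via V T c d \<and> A \<subseteq> supp d" if "finite A" "A \<subseteq> forw V c T" for A
    using that
  proof (induction A rule: finite_induct)
    case empty
    then show ?case using reach_via_refl[OF assms] by blast
  next
    case (insert s A)
    then obtain d where d: "reach_via V T c d" "A \<subseteq> supp d" by blast
    obtain e where e: "reach_via V T c e" "s \<in> supp e" using insert.prems by (auto simp: forw_eq)
    \<comment> \<open>The weights sum to 1, so the combined starting point is c itself.\<close>
    have "reach_via V T c (\<lambda>s. 1/2 * d s + 1/2 * e s)"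
      using reach_via_lincomb[OF d(1) e(1), of "1/2" "1/2"] by (simp flip: distrib_right)
    moreover have "supp (\<lambda>s. 1/2 * d s + 1/2 * e s) = supp d \<union> supp e"
      using d e reach_via_configs by (intro supp_lincomb) auto
    ultimately show ?case using d e by blast
  qed
  moreover have "forw V c T \<subseteq> states V" by (auto simp: forw_def)
  ultimately obtain d where "reach_via V T c d" "forw V c T \<subseteq> supp d"
    using finite_states finite_subset by (metis subset_refl)
  then show ?thesis by (auto simp: forw_eq)
qed

lemma backw_attained:
  assumes "c \<in> configs V"
  shows "\<exists>d. reach_via V T d c \<and> supp d = backw V c T"
proof -
  have "\<exists>d. reach_via V T d c \<and> A \<subseteq> supp d" if "finite A" "A \<subseteq> backw V c T" for A
    using that
  proof (induction A rule: finite_induct)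
    case empty
    then show ?case using reach_via_refl[OF assms] by blast
  next
    case (insert s A)
    then obtain d where d: "reach_via V T d c" "A \<subseteq> supp d" by blast
    obtain e where e: "reach_via V T e c" "s \<in> supp e" using insert.prems by (auto simp: backw_eq)
    have "reach_via V T (\<lambda>s. 1/2 * d s + 1/2 * e s) c"
      using reach_via_lincomb[OF d(1) e(1), of "1/2" "1/2"] by (simp flip: distrib_right)
    moreover have "supp (\<lambda>s. 1/2 * d s + 1/2 * e s) = supp d \<union> supp e"
      using d e reach_via_configs by (intro supp_lincomb) auto
    ultimately show ?case using d e by blast
  qed
  moreover have "backw V c T \<subseteq> states V" by (auto simp: backw_def)
  ultimately obtain d where "reach_via V T d c" "backw V c T \<subseteq> supp d"
    using finite_states finite_subset by (metis subset_refl)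
  then show ?thesis by (auto simp: backw_eq)
qed

section \<open>What a trace reveals: spread-out configurations and its flow\<close>

text \<open>Averaging the start \<open>c\<close> with a configuration reached after the first step keeps every state
  that is ever occupied nonempty.\<close>

lemma trace_spread_forward:
  "trace V c \<xi> c' \<Longrightarrow>
    \<exists>d. reach_via V (used_transitions \<xi>) c d \<and> supp d = supp c \<union> dst ` used_transitions \<xi>"
proof (induction rule: trace.induct)
  case (Nil c)
  then show ?case using reach_via_refl by fastforce
next
  case (Cons c \<alpha> ts e \<xi> c')
  let ?T = "used_transitions ((\<alpha>, ts) # \<xi>)"
  obtain d where d: "reach_via V (used_transitions \<xi>) e d"
    "supp d = supp e \<union> dst ` used_transitions \<xi>"
    using Cons.IH by blast
  have ce: "reach_via V ?T c e" using Cons.hyps(1) by (auto intro: reach_via_step)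
  have cd: "reach_via V ?T c d"
    by (rule reach_via_trans[OF ce]) (auto intro: reach_via_mono[OF d(1)])
  have conf: "c \<in> configs V" "d \<in> configs V" using cd reach_via_configs by blast+
  have "reach_via V ?T c (\<lambda>s. 1/2 * c s + 1/2 * d s)"
    using reach_via_lincomb[OF reach_via_refl[OF conf(1)] cd, of "1/2" "1/2"]
    by (simp flip: distrib_right)
  moreover have "dst ` set ts \<subseteq> supp e"
    using Cons.hyps(1) by (auto dest: step_dst_supp)
  then have "supp (\<lambda>s. 1/2 * c s + 1/2 * d s) = supp c \<union> dst ` ?T"
    using supp_lincomb[OF conf, of "1/2" "1/2"] d(2) reach_via_supp(1)[OF cd] by auto
  ultimately show ?case by blast
qed

text \<open>The mirror image: the start \<open>c\<close> contributes the sources of the first step,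
  and a spread-out start \<open>d\<close> for the remaining trace contributes all later ones. Both
  lead to c', hence so does their midpoint.\<close>

lemma trace_spread_backward:
  "trace V c \<xi> c' \<Longrightarrow>
    \<exists>d. reach_via V (used_transitions \<xi>) d c' \<and> supp d = supp c' \<union> src ` used_transitions \<xi>"
proof (induction rule: trace.induct)
  case (Nil c)
  then show ?case using reach_via_refl by fastforce
next
  case (Cons c \<alpha> ts e \<xi> c')
  let ?T = "used_transitions ((\<alpha>, ts) # \<xi>)"
  obtain d where d: "reach_via V (used_transitions \<xi>) d c'"
    "supp d = supp c' \<union> src ` used_transitions \<xi>"
    using Cons.IH by blast
  have dc': "reach_via V ?T d c'" by (auto intro: reach_via_mono[OF d(1)])
  have cc': "reach_via V ?T c c'"
    unfolding reach_via_def using Cons.hyps by (blast intro: trace.Cons)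
  have conf: "c \<in> configs V" "d \<in> configs V" using cc' dc' reach_via_configs by blast+
  have "reach_via V ?T (\<lambda>s. 1/2 * c s + 1/2 * d s) c'"
    using reach_via_lincomb[OF cc' dc', of "1/2" "1/2"] by (simp flip: distrib_right)
  moreover have "src ` set ts \<subseteq> supp c"
    using Cons.hyps(1) by (auto dest: step_src_supp)
  \<comment> \<open>The midpoint's support is that of c joined with that of d. It contains all
    sources of used transitions; conversely \<open>reach_via_supp\<close> confines supp c to the
    right-hand side.\<close>
  then have "supp (\<lambda>s. 1/2 * c s + 1/2 * d s) = supp c' \<union> src ` ?T"
    using supp_lincomb[OF conf, of "1/2" "1/2"] d(2) reach_via_supp(2)[OF cc'] by auto
  ultimately show ?case by blast
qed

text \<open>The flow adds up the multiplicities with which each transition is used. Every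
  contribution is positive, so its support is exactly the set of used transitions; balance holds
  step by step.\<close>

lemma trace_flow:
  "trace V c \<xi> d \<Longrightarrow>
    \<exists>\<beta>. (\<forall>t. 0 \<le> \<beta> t) \<and> {t. 0 < \<beta> t} = used_transitions \<xi> \<and> balanced V \<beta> \<and>
        d = (\<lambda>s. c s + (inflow V \<beta> s - outflow V \<beta> s)) \<and> used_transitions \<xi> \<subseteq> transitions V"
proof (induction rule: trace.induct)
  case (Nil c)
  then show ?case
    by (intro exI[of _ "\<lambda>_. 0"]) (simp add: balanced_def inflow_def outflow_def)
next
  case (Cons c \<alpha> ts e \<xi> d)
  then obtain \<beta> where \<beta>: "\<And>t. 0 \<le> \<beta> t" "{t. 0 < \<beta> t} = used_transitions \<xi>" "balanced V \<beta>"
    "d = (\<lambda>s. e s + (inflow V \<beta> s - outflow V \<beta> s))" "used_transitions \<xi> \<subseteq> transitions V"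
    by blast
  have st: "0 < \<alpha>" "rendezvous V ts"
    "e = (\<lambda>s. c s + \<alpha> * (inflow V (ind ts) s - outflow V (ind ts) s))"
    using Cons.hyps(1) by (auto simp: step_iff)
  let ?\<gamma> = "\<lambda>t. 1 * \<beta> t + \<alpha> * ind ts t"
  have "0 < ?\<gamma> t \<longleftrightarrow> t \<in> set ts \<union> used_transitions \<xi>" "0 \<le> ?\<gamma> t" for t
    using \<beta>(1)[of t] \<beta>(2) st(1) by (auto simp: ind_def add_nonneg_pos)
  moreover have "balanced V ?\<gamma>" using \<beta>(3) balanced_ind[OF st(2)] by (rule balanced_lincomb)
  moreover have "d = (\<lambda>s. c s + (inflow V ?\<gamma> s - outflow V ?\<gamma> s))"
    unfolding inflow_lincomb outflow_lincomb \<beta>(4) st(3) by (simp add: algebra_simps)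
  moreover have "set ts \<subseteq> transitions V" using st(2) by (simp add: rendezvous_def)
  ultimately show ?case using \<beta>(5) by (intro exI[of _ ?\<gamma>]) auto
qed

section \<open>Realising a balanced flow by a trace\<close>

text \<open>When c covers the whole outflow at once, the order of firing is harmless. Each round
  fires one rendezvous with the largest multiplicity the flow allows, which removes a transition
  from the support of the flow; the induction is on the size of that support.\<close>

lemma reach_via_balanced_small:
  assumes "\<And>t. t \<in> transitions V \<Longrightarrow> 0 \<le> \<beta> t" "balanced V \<beta>" "c \<in> configs V"
    and "\<And>s. outflow V \<beta> s \<le> c s" and "{t \<in> transitions V. 0 < \<beta> t} \<subseteq> T"
  shows "reach_via V T c (\<lambda>s. c s + (inflow V \<beta> s - outflow V \<beta> s))"
  using assms
proof (induction "card {t \<in> transitions V. 0 < \<beta> t}" arbitrary: \<beta> c rule: less_induct)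
  case less
  show ?case
  proof (cases "{t \<in> transitions V. 0 < \<beta> t} = {}")
    case True
    then have "\<beta> t = 0" if "t \<in> transitions V" for t
      using less.prems(1)[OF that] that by (metis (mono_tags, lifting) empty_iff le_less mem_Collect_eq)
    then show ?thesis using less.prems(3) by (simp add: inflow_def outflow_def reach_via_refl)
  next
    case False
    then obtain t0 where t0: "t0 \<in> transitions V" "0 < \<beta> t0" by blast
    then obtain a i0 where a: "rdz t0 = (a, i0)" "a \<in> actions V" "i0 \<in> {1..arity V}"
      by (elim rdz_in_alphabet)
    \<comment> \<open>By balance, positive weight at index i0 of the action a forces positive weight
      at every index, so a full tuple can be assembled.\<close>
    have "\<exists>t. t \<in> transitions V \<and> rdz t = (a, Suc i) \<and> 0 < \<beta> t" if i: "i < arity V" for i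
    proof (rule ccontr)
      assume no: "\<not> ?thesis"
      have "0 < (\<Sum>t\<in>{t \<in> transitions V. rdz t = (a, i0)}. \<beta> t)"
        using t0 a less.prems(1) finite_transitions by (intro sum_pos2[of _ t0]) auto
      also have "\<dots> = (\<Sum>t\<in>{t \<in> transitions V. rdz t = (a, Suc i)}. \<beta> t)"
        using less.prems(2)[unfolded balanced_def, rule_format, OF a(2,3), of "Suc i"] i by simp
      also have "\<dots> \<le> 0" using no by (intro sum_nonpos) force
      finally show False by simp
    qed
    then obtain f where f: "\<And>i. i < arity V \<Longrightarrow> f i \<in> transitions V"
      "\<And>i. i < arity V \<Longrightarrow> rdz (f i) = (a, Suc i)" "\<And>i. i < arity V \<Longrightarrow> 0 < \<beta> (f i)"
      by metis
    define ts where "ts = map f [0..<arity V]"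
    have ts: "rendezvous V ts" and ts_pos: "\<And>t. t \<in> set ts \<Longrightarrow> 0 < \<beta> t"
      and ts_sub: "set ts \<subseteq> transitions V"
      unfolding rendezvous_def ts_def using f a by auto
    \<comment> \<open>The largest multiplicity that keeps the remaining flow nonnegative; it
      exhausts the transition \<open>t1\<close>.\<close>
    define \<mu> where "\<mu> = Min (\<beta> ` set ts)"
    have "set ts \<noteq> {}" using cvrs by (auto simp: ts_def is_cvrs_def)
    then have "\<mu> \<in> \<beta> ` set ts" and \<mu>_le: "\<And>t. t \<in> set ts \<Longrightarrow> \<mu> \<le> \<beta> t"
      unfolding \<mu>_def by (auto intro!: Min_in)
    then obtain t1 where t1: "t1 \<in> set ts" "\<beta> t1 = \<mu>" by blast
    have \<mu>_pos: "0 < \<mu>" using t1 ts_pos by blast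
    define \<gamma> where "\<gamma> = (\<lambda>t. 1 * \<beta> t + (-\<mu>) * ind ts t)"
    have \<gamma>_nonneg: "0 \<le> \<gamma> t" if "t \<in> transitions V" for t
      using less.prems(1)[OF that] \<mu>_le by (auto simp: \<gamma>_def ind_def)
    have \<gamma>_le: "\<gamma> t \<le> \<beta> t" for t using \<mu>_pos by (auto simp: \<gamma>_def ind_def)
    have \<gamma>_bal: "balanced V \<gamma>"
      unfolding \<gamma>_def using less.prems(2) balanced_ind[OF ts] by (rule balanced_lincomb)
    have inf: "inflow V \<beta> s = inflow V \<gamma> s + \<mu> * inflow V (ind ts) s"
      and outf: "outflow V \<beta> s = outflow V \<gamma> s + \<mu> * outflow V (ind ts) s" for s
      unfolding \<gamma>_def inflow_lincomb outflow_lincomb by simp_all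
    define d where "d = (\<lambda>s. c s + \<mu> * (inflow V (ind ts) s - outflow V (ind ts) s))"
    have in_nn: "0 \<le> \<mu> * inflow V (ind ts) s" for s
      using \<mu>_pos by (auto intro!: mult_nonneg_nonneg inflow_nonneg simp: ind_def)
    have out_nn: "0 \<le> outflow V \<gamma> s" for s by (intro outflow_nonneg \<gamma>_nonneg)
    \<comment> \<open>The invariant for the next round: firing takes \<mu> times the outflow of
      \<open>ind ts\<close> from both the configuration and the demand, and the inflow can only
      help.\<close>
    have d_ge: "outflow V \<gamma> s \<le> d s" for s
      using less.prems(4)[of s] in_nn[of s] unfolding d_def outf right_diff_distrib by linarith
    have d_conf: "d \<in> configs V"
      unfolding configs_def
    proof (intro CollectI conjI ballI allI impI)
      show "0 \<le> d s" for s using d_ge[of s] out_nn[of s] by linarith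
      show "d s = 0" if "s \<notin> states V" for s
        using that less.prems(3) by (simp add: d_def inflow_outside outflow_outside configs_def)
    qed
    have "step V c \<mu> ts d"
      unfolding step_iff
    proof (intro conjI allI)
      show "\<mu> * outflow V (ind ts) s \<le> c s" for s
        using less.prems(4)[of s] out_nn[of s] unfolding outf by linarith
    qed (use less.prems d_conf \<mu>_pos ts d_def in auto)
    moreover have "set ts \<subseteq> T" using ts_pos ts_sub less.prems(5) by blast
    ultimately have "reach_via V T c d" by (rule reach_via_step)
    moreover have "reach_via V T d (\<lambda>s. d s + (inflow V \<gamma> s - outflow V \<gamma> s))"
    proof (rule less.hyps[OF _ \<gamma>_nonneg \<gamma>_bal d_conf d_ge])
      have sub: "{t \<in> transitions V. 0 < \<gamma> t} \<subseteq> {t \<in> transitions V. 0 < \<beta> t}"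
        using \<gamma>_le less_le_trans by blast
      moreover have "t1 \<in> {t \<in> transitions V. 0 < \<beta> t} - {t \<in> transitions V. 0 < \<gamma> t}"
        using t1 ts_sub \<mu>_pos by (auto simp: \<gamma>_def ind_def)
      ultimately show "card {t \<in> transitions V. 0 < \<gamma> t} < card {t \<in> transitions V. 0 < \<beta> t}"
        using finite_transitions by (intro psubset_card_mono) auto
      show "{t \<in> transitions V. 0 < \<gamma> t} \<subseteq> T" using sub less.prems(5) by blast
    qed
    moreover have "(\<lambda>s. d s + (inflow V \<gamma> s - outflow V \<gamma> s)) =
        (\<lambda>s. c s + (inflow V \<beta> s - outflow V \<beta> s))"
      by (simp add: d_def inf outf algebra_simps)
    ultimately show ?thesis using reach_via_trans by metis
  qed
qed

text \<open>The outflow is positive only at states where x and y are both positive, so a fraction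
  1/N of it lies below min(x, y) and hence below every point of the segment from x to y. N
  increments of size 1/N then suffice.\<close>

lemma reach_via_balanced:
  assumes nonneg: "\<And>t. t \<in> transitions V \<Longrightarrow> 0 \<le> \<beta> t" and bal: "balanced V \<beta>"
    and x: "x \<in> configs V" and y: "y \<in> configs V"
    and xy: "y = (\<lambda>s. x s + (inflow V \<beta> s - outflow V \<beta> s))"
    and src: "src ` {t \<in> transitions V. 0 < \<beta> t} \<subseteq> supp x \<inter> supp y"
  shows "reach_via V {t \<in> transitions V. 0 < \<beta> t} x y"
proof -
  let ?T = "{t \<in> transitions V. 0 < \<beta> t}"
  obtain N :: nat where N: "N \<ge> 2" "\<forall>s\<in>states V. outflow V \<beta> s \<le> of_nat N * min (x s) (y s)"
  proof -
    have "0 < min (x s) (y s)" if "0 < outflow V \<beta> s" for s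
      using outflow_posD[OF that] src by (auto simp: supp_def)
    then show ?thesis
      using that finite_dominated[OF finite_states, of "\<lambda>s. min (x s) (y s)" "outflow V \<beta>"]
        configs_nonneg[OF x] configs_nonneg[OF y] by auto
  qed
  define \<delta> :: rat where "\<delta> = 1 / of_nat N"
  have \<delta>: "0 < \<delta>" "\<delta> * of_nat N = 1" using N(1) by (auto simp: \<delta>_def)
  \<comment> \<open>The form with two summands lets the \<open>lincomb\<close> lemmas apply to a
    plain scaling.\<close>
  define \<gamma> where "\<gamma> = (\<lambda>t. \<delta> * \<beta> t + 0 * \<beta> t)"
  have \<gamma>_out: "outflow V \<gamma> s = \<delta> * outflow V \<beta> s" and \<gamma>_in: "inflow V \<gamma> s = \<delta> * inflow V \<beta> s" for s
    unfolding \<gamma>_def inflow_lincomb outflow_lincomb by simp_all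
  have \<gamma>_le: "outflow V \<gamma> s \<le> min (x s) (y s)" for s
  proof (cases "s \<in> states V")
    case True
    then have "\<delta> * outflow V \<beta> s \<le> \<delta> * (of_nat N * min (x s) (y s))"
      using N(2) \<delta>(1) by (intro mult_left_mono) auto
    also have "\<dots> = min (x s) (y s)" using \<delta>(2) by (simp flip: mult.assoc)
    finally show ?thesis by (simp add: \<gamma>_out)
  next
    case False
    then show ?thesis using configs_nonneg[OF x] configs_nonneg[OF y] by (simp add: outflow_outside)
  qed
  \<comment> \<open>The n-th point of the segment; z 0 is x and, as \<delta> N = 1, z N is y.
    Consecutive points differ by the net effect of \<gamma>.\<close>
  define z where "z n = (\<lambda>s. (1 - \<delta> * of_nat n) * x s + (\<delta> * of_nat n) * y s)" for n :: nat
  have "reach_via V ?T x (z n)" if "n \<le> N" for n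
    using that
  proof (induction n)
    case 0
    then show ?case using reach_via_refl[OF x] by (simp add: z_def)
  next
    case (Suc n)
    have "\<delta> * of_nat n \<le> \<delta> * of_nat N" using Suc.prems \<delta>(1) by (intro mult_left_mono) auto
    then have le1: "0 \<le> 1 - \<delta> * of_nat n" "0 \<le> \<delta> * of_nat n" using \<delta> by auto
    have z_conf: "z n \<in> configs V" unfolding z_def using x y le1 by (rule configs_lincomb)
    have z_ge: "outflow V \<gamma> s \<le> z n s" for s
    proof -
      \<comment> \<open>The weights are nonnegative and sum to 1, so z n dominates min(x,
        y).\<close>
      have "outflow V \<gamma> s \<le> (1 - \<delta> * of_nat n) * min (x s) (y s) + (\<delta> * of_nat n) * min (x s) (y s)"
        using \<gamma>_le[of s] by (simp add: left_diff_distrib)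
      also have "\<dots> \<le> z n s"
        unfolding z_def using le1 by (intro add_mono mult_left_mono) auto
      finally show ?thesis .
    qed
    have "reach_via V ?T x (z n)" using Suc by simp
    moreover have "reach_via V ?T (z n) (\<lambda>s. z n s + (inflow V \<gamma> s - outflow V \<gamma> s))"
    proof (rule reach_via_balanced_small[OF _ _ z_conf z_ge])
      show "balanced V \<gamma>" unfolding \<gamma>_def using bal bal by (rule balanced_lincomb)
      show "0 \<le> \<gamma> t" if "t \<in> transitions V" for t using nonneg[OF that] \<delta>(1) by (simp add: \<gamma>_def)
      show "{t \<in> transitions V. 0 < \<gamma> t} \<subseteq> ?T" using \<delta>(1) by (auto simp: \<gamma>_def zero_less_mult_iff)
    qed
    ultimately have "reach_via V ?T x (\<lambda>s. z n s + (inflow V \<gamma> s - outflow V \<gamma> s))"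
      by (rule reach_via_trans)
    also have "(\<lambda>s. z n s + (inflow V \<gamma> s - outflow V \<gamma> s)) = z (Suc n)"
      by (simp add: z_def xy \<gamma>_in \<gamma>_out algebra_simps)
    finally show ?case .
  qed
  from this[of N] show ?thesis using \<delta>(2) by (simp add: z_def)
qed

section \<open>The two directions of the characterisation\<close>

text \<open>\<open>reach_via_supp\<close> bounds both sets from above, since new support appears
  only at destinations and lost support only at sources; the spread-out configurations attain the
  bounds.\<close>

lemma forw_backw_used_transitions:
  assumes "trace V c \<xi> c'"
  shows "forw V c (used_transitions \<xi>) = supp c \<union> dst ` used_transitions \<xi>"
    and "backw V c' (used_transitions \<xi>) = supp c' \<union> src ` used_transitions \<xi>"
proof -
  let ?T = "used_transitions \<xi>"
  obtain d where d: "reach_via V ?T c d" "supp d = supp c \<union> dst ` ?T"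
    using trace_spread_forward[OF assms] by blast
  show "forw V c ?T = supp c \<union> dst ` ?T"
  proof (rule subset_antisym)
    show "forw V c ?T \<subseteq> supp c \<union> dst ` ?T"
      unfolding forw_eq by (rule Union_least) (auto dest!: reach_via_supp(1))
    show "supp c \<union> dst ` ?T \<subseteq> forw V c ?T"
      unfolding forw_eq d(2)[symmetric] using d(1) by (intro Union_upper) blast
  qed
  obtain e where e: "reach_via V ?T e c'" "supp e = supp c' \<union> src ` ?T"
    using trace_spread_backward[OF assms] by blast
  show "backw V c' ?T = supp c' \<union> src ` ?T"
  proof (rule subset_antisym)
    show "backw V c' ?T \<subseteq> supp c' \<union> src ` ?T"
      unfolding backw_eq by (rule Union_least) (auto dest!: reach_via_supp(2))
    show "supp c' \<union> src ` ?T \<subseteq> backw V c' ?T"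
      unfolding backw_eq e(2)[symmetric] using e(1) by (intro Union_upper) blast
  qed
qed

text \<open>The trace runs from c to x to y to c', where x and y are positive on all of
  \<open>forw V c T\<close>. Only the middle leg has to be constructed from a flow; the outer legs
  are scaled copies of existing traces.\<close>

lemma reachable_of_flow:
  assumes c: "c \<in> configs V" and c': "c' \<in> configs V"
    and nonneg: "\<And>t. t \<in> transitions V \<Longrightarrow> 0 \<le> \<alpha> t" and bal: "balanced V \<alpha>"
    and flow: "c' = (\<lambda>s. c s + (inflow V \<alpha> s - outflow V \<alpha> s))"
    and T: "T = {t \<in> transitions V. 0 < \<alpha> t}"
    and src: "src ` T \<subseteq> backw V c' T"
    and eq: "forw V c T = backw V c' T"
  shows "reach_via V T c c'"
proof -
  obtain d where d: "reach_via V T c d" "supp d = forw V c T" using forw_attained[OF c] by blast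
  obtain d' where d': "reach_via V T d' c'" "supp d' = backw V c' T"
    using backw_attained[OF c'] by blast
  have conf: "d \<in> configs V" "d' \<in> configs V" using d d' reach_via_configs by blast+
  have flow_of: "\<exists>\<beta>. (\<forall>t. 0 \<le> \<beta> t) \<and> {t. 0 < \<beta> t} \<subseteq> T \<and> balanced V \<beta> \<and>
        (\<forall>s. v s = u s + (inflow V \<beta> s - outflow V \<beta> s))" if "reach_via V T u v" for u v
  proof -
    obtain \<xi> where \<xi>: "trace V u \<xi> v" "used_transitions \<xi> \<subseteq> T"
      using \<open>reach_via V T u v\<close> unfolding reach_via_def by blast
    from trace_flow[OF \<xi>(1)] obtain \<beta> where "\<forall>t. 0 \<le> \<beta> t" "{t. 0 < \<beta> t} = used_transitions \<xi>"
      "balanced V \<beta>" "v = (\<lambda>s. u s + (inflow V \<beta> s - outflow V \<beta> s))" by blast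
    then show ?thesis using \<xi>(2) by (intro exI[of _ \<beta>]) simp
  qed
  obtain \<beta> where \<beta>: "\<And>t. 0 \<le> \<beta> t" "{t. 0 < \<beta> t} \<subseteq> T" "balanced V \<beta>"
    "\<And>s. d s = c s + (inflow V \<beta> s - outflow V \<beta> s)"
    using flow_of[OF d(1)] by blast
  obtain \<gamma> where \<gamma>: "\<And>t. 0 \<le> \<gamma> t" "{t. 0 < \<gamma> t} \<subseteq> T" "balanced V \<gamma>"
    "\<And>s. c' s = d' s + (inflow V \<gamma> s - outflow V \<gamma> s)"
    using flow_of[OF d'(1)] by blast
  have "0 < \<alpha> t" if "0 < \<beta> t + \<gamma> t" for t
  proof -
    have "0 < \<beta> t \<or> 0 < \<gamma> t" using that by linarith
    then show ?thesis using \<beta>(2) \<gamma>(2) T by blast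
  qed
  \<comment> \<open>The flows of the outer legs are supported where \<alpha> is positive, so a 1/N
    portion of them can be subtracted from \<alpha> without leaving the nonnegative range.\<close>
  then obtain N :: nat where N: "N \<ge> 2" "\<forall>t\<in>transitions V. \<beta> t + \<gamma> t \<le> of_nat N * \<alpha> t"
    using finite_dominated[OF finite_transitions, of \<alpha> "\<lambda>t. \<beta> t + \<gamma> t"] nonneg by blast
  define \<epsilon> :: rat where "\<epsilon> = 1 / of_nat N"
  have \<epsilon>: "0 < \<epsilon>" "0 < 1 - \<epsilon>" "\<epsilon> * of_nat N = 1" using N(1) by (auto simp: \<epsilon>_def field_simps)
  define x where "x = (\<lambda>s. (1 - \<epsilon>) * c s + \<epsilon> * d s)"
  define y where "y = (\<lambda>s. (1 - \<epsilon>) * c' s + \<epsilon> * d' s)"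
  \<comment> \<open>Writing D for net effect, d = c + D(\<beta>), c' = d' + D(\<gamma>) and c' = c +
    D(\<alpha>) give y - x = D(\<alpha>) - \<epsilon> (D(\<beta>) + D(\<gamma>)), which is the net
    effect of \<zeta>.\<close>
  define \<zeta> where "\<zeta> = (\<lambda>t. 1 * \<alpha> t + (-\<epsilon>) * (1 * \<beta> t + 1 * \<gamma> t))"
  have \<zeta>_le: "\<zeta> t \<le> \<alpha> t" for t
    using \<epsilon>(1) mult_nonneg_nonneg[of \<epsilon> "\<beta> t + \<gamma> t"] \<beta>(1) \<gamma>(1) by (simp add: \<zeta>_def)
  then have \<zeta>_T: "{t \<in> transitions V. 0 < \<zeta> t} \<subseteq> T" using T less_le_trans by blast
  have cx: "reach_via V T c x"
    using reach_via_lincomb[OF reach_via_refl[OF c] d(1) \<epsilon>(2,1)] by (simp add: x_def left_diff_distrib)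
  have yc': "reach_via V T y c'"
    using reach_via_lincomb[OF reach_via_refl[OF c'] d'(1) \<epsilon>(2,1)] by (simp add: y_def left_diff_distrib)
  \<comment> \<open>By the equality of \<open>forw\<close> and \<open>backw\<close>, both supports
    contain this common set, and with it every source of T.\<close>
  have supports: "supp x = supp c \<union> forw V c T" "supp y = supp c' \<union> forw V c T"
    unfolding x_def y_def
    using supp_lincomb[OF c conf(1) \<epsilon>(2,1)] supp_lincomb[OF c' conf(2) \<epsilon>(2,1)] d(2) d'(2) eq by auto
  have "reach_via V {t \<in> transitions V. 0 < \<zeta> t} x y"
  proof (rule reach_via_balanced)
    show "x \<in> configs V" "y \<in> configs V" using cx yc' reach_via_configs by blast+
    show "0 \<le> \<zeta> t" if "t \<in> transitions V" for t
    proof -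
      have "\<epsilon> * (\<beta> t + \<gamma> t) \<le> \<epsilon> * (of_nat N * \<alpha> t)"
        using N(2) that \<epsilon>(1) by (intro mult_left_mono) auto
      also have "\<dots> = \<alpha> t" using \<epsilon>(3) by (simp flip: mult.assoc)
      finally show ?thesis by (simp add: \<zeta>_def)
    qed
    show "balanced V \<zeta>" unfolding \<zeta>_def by (intro balanced_lincomb bal \<beta>(3) \<gamma>(3))
    show "src ` {t \<in> transitions V. 0 < \<zeta> t} \<subseteq> supp x \<inter> supp y"
      using \<zeta>_T src supports eq by blast
    show "y = (\<lambda>s. x s + (inflow V \<zeta> s - outflow V \<zeta> s))"
    proof
      fix s
      have d's: "d' s = c' s - (inflow V \<gamma> s - outflow V \<gamma> s)" using \<gamma>(4)[of s] by simp
      have c's: "c' s = c s + (inflow V \<alpha> s - outflow V \<alpha> s)" by (simp add: flow)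
      show "y s = x s + (inflow V \<zeta> s - outflow V \<zeta> s)"
        unfolding \<zeta>_def inflow_lincomb outflow_lincomb x_def y_def d's c's \<beta>(4)
        by (simp add: algebra_simps)
    qed
  qed
  then have "reach_via V T x y" using \<zeta>_T reach_via_mono by blast
  then show ?thesis using cx yc' reach_via_trans by blast
qed

end

theorem theorem7p22:
  fixes V :: "('a, 's) cvrs" and c c' :: "'s \<Rightarrow> rat"
  assumes "is_cvrs V" and "c \<in> configs V" and "c' \<in> configs V"
  shows "reachable V c c' \<longleftrightarrow>
    (\<exists>\<alpha> :: ('a, 's) transition \<Rightarrow> rat.
       (\<forall>t\<in>transitions V. 0 \<le> \<alpha> t) \<and>
       c' = (\<lambda>s. c s + (\<Sum>t\<in>transitions V. \<alpha> t * (in_vec t s - out_vec t s))) \<and>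
       (\<forall>a\<in>actions V. \<forall>i\<in>{1..arity V}. \<forall>j\<in>{1..arity V}.
          (\<Sum>t\<in>{t \<in> transitions V. rdz t = (a, i)}. \<alpha> t) =
          (\<Sum>t\<in>{t \<in> transitions V. rdz t = (a, j)}. \<alpha> t)) \<and>
       (let R' = {t \<in> transitions V. 0 < \<alpha> t} in
          src ` R' \<subseteq> backw V c' R' \<and>
          dst ` R' \<subseteq> forw V c R' \<and>
          forw V c R' = backw V c' R'))" (is "_ \<longleftrightarrow> ?rhs")
proof
  assume "reachable V c c'"
  then obtain \<xi> where \<xi>: "trace V c \<xi> c'" unfolding reachable_def by blast
  then obtain \<beta> where \<beta>: "\<forall>t. 0 \<le> \<beta> t" "{t. 0 < \<beta> t} = used_transitions \<xi>" "balanced V \<beta>"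
    "c' = (\<lambda>s. c s + (inflow V \<beta> s - outflow V \<beta> s))" "used_transitions \<xi> \<subseteq> transitions V"
    using trace_flow[OF assms(1)] by blast
  have used: "{t \<in> transitions V. 0 < \<beta> t} = used_transitions \<xi>" using \<beta>(2,5) by blast
  \<comment> \<open>The flow of the trace is the witness. For condition (3), \<open>forw\<close> is
    supp c with the used destinations and \<open>backw\<close> is supp c' with the used sources;
    \<open>trace_supp\<close> equates the two.\<close>
  show ?rhs
    unfolding Let_def sum_displacement
  proof (intro exI[of _ \<beta>] conjI)
    show "\<forall>t\<in>transitions V. 0 \<le> \<beta> t" using \<beta>(1) by blast
    show "c' = (\<lambda>s. c s + (inflow V \<beta> s - outflow V \<beta> s))" by (rule \<beta>(4))
    show "\<forall>a\<in>actions V. \<forall>i\<in>{1..arity V}. \<forall>j\<in>{1..arity V}.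
        (\<Sum>t\<in>{t \<in> transitions V. rdz t = (a, i)}. \<beta> t) =
        (\<Sum>t\<in>{t \<in> transitions V. rdz t = (a, j)}. \<beta> t)"
      by (rule \<beta>(3)[unfolded balanced_def])
    show "dst ` {t \<in> transitions V. 0 < \<beta> t} \<subseteq> forw V c {t \<in> transitions V. 0 < \<beta> t}"
      unfolding used forw_backw_used_transitions(1)[OF assms(1) \<xi>] by (rule Un_upper2)
  qed (simp_all add: used forw_backw_used_transitions[OF assms(1) \<xi>] trace_supp[OF assms(1) \<xi>])
next
  assume ?rhs
  then obtain \<alpha> where "\<forall>t\<in>transitions V. 0 \<le> \<alpha> t" "balanced V \<alpha>"
    "c' = (\<lambda>s. c s + (inflow V \<alpha> s - outflow V \<alpha> s))"
    "src ` {t \<in> transitions V. 0 < \<alpha> t} \<subseteq> backw V c' {t \<in> transitions V. 0 < \<alpha> t}"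
    "forw V c {t \<in> transitions V. 0 < \<alpha> t} = backw V c' {t \<in> transitions V. 0 < \<alpha> t}"
    unfolding Let_def sum_displacement balanced_def[symmetric] by (elim exE conjE) (rule that)
  then have "reach_via V {t \<in> transitions V. 0 < \<alpha> t} c c'"
    using assms by (intro reachable_of_flow) auto
  then show "reachable V c c'" unfolding reach_via_def reachable_def by blast
qed

end
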